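(* Let $A,B\subseteq\{1,\dots,n\}$. If $|B|\ge2$, then $\psi(z_{A,B})=0$.
   Context: Let $k$ be a field and $n\ge 1$. $Q_n$ is the associative unital $k$-algebra with generators $z_{A,i}$, for $A\subseteq\{1,\dots,n\}$ and $i\in\{1,\dots,n\}\setminus A$, and defining relations $$z_{A\cup\{i\},j}+z_{A,i}=z_{A\cup\{j\},i}+z_{A,j},\qquad z_{A\cup\{i\},j}\,z_{A,i}=z_{A\cup\{j\},i}\,z_{A,j}$$ for all $A$ and all distinct $i,j\notin A$. $T_n\subseteq Q_n$ is the $k$-linear span of all $z_{A,i}$, and $\bar T_n=T_n\oplus k\cdot1$. $\psi:Q_n\to k[v_1,\dots,v_n]$ is the algebra homomorphism to the commutative polynomial ring with $\psi(z_{A,i})=v_i$ for all $A$ and $i\notin A$. $K_n=k[v_1,\dots,v_n]/(v_i^2+v_i:1\le i\le n)$, and $w_i$ is the image of $v_i$. There is an algebra homomorphism $\phi:Q_n\to K_n$ with $\phi(z_{A,i})=w_i\prod_{j\in A}(1+w_j)$, and its restriction $\phi|_{\bar T_n}:\bar T_n\to K_n$ is an isomorphism of vector spaces. For $A,B\subseteq\{1,\dots,n\}$, $z_{A,B}$ is the projection to $T_n$ (along $k\cdot 1$) of $(\phi|_{\bar T_n})^{-1}\big(\prod_{i\in B}w_i\prod_{j\in A}(1+w_j)\big)$. *)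

theory Defs
  imports Complex_Main "HOL-Library.Poly_Mapping"
begin

section \<open>Free algebras\<close>

text \<open>
  Poly_Mapping writes monoids additively, so concatenation of words is addition here.  The free
  associative unital algebra over \<open>'k\<close> on the set \<open>'g\<close> of generators is then the monoid algebra
  \<open>'g word \<Rightarrow>\<^sub>0 'k\<close>, whose multiplication is not commutative.
\<close>

datatype 'g word = Word (letters: "'g list")

instantiation word :: (type) monoid_add
begin

definition zero_word :: "'g word" where
  "zero_word = Word []"

definition plus_word :: "'g word \<Rightarrow> 'g word \<Rightarrow> 'g word" where
  "plus_word u v = Word (letters u @ letters v)"

instance
  by standard (simp_all add: zero_word_def plus_word_def)

end

lemma letters_zero [simp]: "letters 0 = []"
  by (simp add: zero_word_def)

lemma letters_plus [simp]: "letters (u + v) = letters u @ letters v"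
  by (simp add: plus_word_def)

text \<open>
  The homomorphism out of the free algebra that extends the assignment \<open>f\<close> on generators;
  \<open>\<iota>\<close> is the structure map from the base field to the target algebra.
\<close>

definition free_eval :: "('k::field \<Rightarrow> 'a::comm_ring_1) \<Rightarrow> ('g \<Rightarrow> 'a) \<Rightarrow> ('g word \<Rightarrow>\<^sub>0 'k) \<Rightarrow> 'a" where
  "free_eval \<iota> f p = (\<Sum>u\<in>Poly_Mapping.keys p. \<iota> (Poly_Mapping.lookup p u) * prod_list (map f (letters u)))"

locale scalar_embedding =
  fixes \<iota> :: "'k::field \<Rightarrow> 'a::comm_ring_1"
  assumes emb_zero: "\<iota> 0 = 0"
    and emb_one: "\<iota> 1 = 1"
    and emb_add: "\<iota> (a + b) = \<iota> a + \<iota> b"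
    and emb_mult: "\<iota> (a * b) = \<iota> a * \<iota> b"
begin

lemma free_eval_superset:
  assumes "finite S" "Poly_Mapping.keys p \<subseteq> S"
  shows "free_eval \<iota> f p = (\<Sum>u\<in>S. \<iota> (Poly_Mapping.lookup p u) * prod_list (map f (letters u)))"
  unfolding free_eval_def using assms
  by (intro sum.mono_neutral_left) (auto simp: in_keys_iff emb_zero)

lemma free_eval_add: "free_eval \<iota> f (p + q) = free_eval \<iota> f p + free_eval \<iota> f q"
proof -
  have "Poly_Mapping.keys (p + q) \<subseteq> Poly_Mapping.keys p \<union> Poly_Mapping.keys q"
    by (rule Poly_Mapping.keys_add)
  then show ?thesis
    by (simp add: free_eval_superset[of "Poly_Mapping.keys p \<union> Poly_Mapping.keys q"] lookup_add emb_add
        distrib_right sum.distrib)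
qed

lemma free_eval_zero: "free_eval \<iota> f 0 = 0"
  by (simp add: free_eval_def)

lemma free_eval_single:
  "free_eval \<iota> f (Poly_Mapping.single u c) = \<iota> c * prod_list (map f (letters u))"
  by (simp add: free_eval_def emb_zero)

lemma free_eval_one: "free_eval \<iota> f 1 = 1"
  using free_eval_single[of f 0 1] by (simp add: emb_one)

lemma free_eval_minus: "free_eval \<iota> f (p - q) = free_eval \<iota> f p - free_eval \<iota> f q"
  using free_eval_add[of f "p - q" q] by (simp add: algebra_simps)

lemma free_eval_sum: "free_eval \<iota> f (sum g S) = (\<Sum>x\<in>S. free_eval \<iota> f (g x))"
  by (induction S rule: infinite_finite_induct) (simp_all add: free_eval_add free_eval_zero)

lemma free_eval_mult: "free_eval \<iota> f (p * q) = free_eval \<iota> f p * free_eval \<iota> f q"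
proof -
  have expand: "r = (\<Sum>u\<in>Poly_Mapping.keys r. Poly_Mapping.single u (Poly_Mapping.lookup r u))" for r :: "'g word \<Rightarrow>\<^sub>0 'k"
    by (rule poly_mapping_eqI)
      (simp add: lookup_sum lookup_single when_def in_keys_iff)
  have "p * q = (\<Sum>u\<in>Poly_Mapping.keys p. \<Sum>v\<in>Poly_Mapping.keys q. Poly_Mapping.single (u + v) (Poly_Mapping.lookup p u * Poly_Mapping.lookup q v))"
    by (subst expand[of p], subst expand[of q]) (simp add: sum_product mult_single)
  then have "free_eval \<iota> f (p * q) =
      (\<Sum>u\<in>Poly_Mapping.keys p. \<Sum>v\<in>Poly_Mapping.keys q. (\<iota> (Poly_Mapping.lookup p u) * prod_list (map f (letters u))) *
        (\<iota> (Poly_Mapping.lookup q v) * prod_list (map f (letters v))))"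
    by (simp add: free_eval_sum free_eval_single emb_mult ac_simps)
  then show ?thesis
    by (simp add: free_eval_def sum_product)
qed

end


section \<open>Quotients by two-sided ideals\<close>

definition two_sided_ideal :: "'a::ring_1 set \<Rightarrow> bool" where
  "two_sided_ideal I \<longleftrightarrow> 0 \<in> I \<and> (\<forall>x\<in>I. \<forall>y\<in>I. x + y \<in> I) \<and>
     (\<forall>x\<in>I. \<forall>a. a * x \<in> I \<and> x * a \<in> I)"

definition cong_mod :: "'a::ring_1 set \<Rightarrow> 'a \<Rightarrow> 'a \<Rightarrow> bool" where
  "cong_mod S x y \<longleftrightarrow> x - y \<in> two_sided_ideal hull S"

lemma two_sided_ideal_hull: "two_sided_ideal (two_sided_ideal hull S)"
  by (rule hull_in) (auto simp: two_sided_ideal_def)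

lemma hull_add: "x \<in> two_sided_ideal hull S \<Longrightarrow> y \<in> two_sided_ideal hull S \<Longrightarrow>
    x + y \<in> two_sided_ideal hull S"
  and hull_zero: "0 \<in> two_sided_ideal hull S"
  and hull_mult_left: "x \<in> two_sided_ideal hull S \<Longrightarrow> a * x \<in> two_sided_ideal hull S"
  and hull_mult_right: "x \<in> two_sided_ideal hull S \<Longrightarrow> x * a \<in> two_sided_ideal hull S"
  using two_sided_ideal_hull[of S] by (auto simp: two_sided_ideal_def)

lemma hull_uminus: "x \<in> two_sided_ideal hull S \<Longrightarrow> - x \<in> two_sided_ideal hull S"
  using hull_mult_left[of x S "-1"] by simp

lemma equivp_cong_mod: "equivp (cong_mod S)"
proof (rule equivpI)
  show "reflp (cong_mod S)"
    by (auto simp: reflp_def cong_mod_def hull_zero)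
  show "symp (cong_mod S)"
    unfolding symp_def cong_mod_def by (metis hull_uminus minus_diff_eq)
  show "transp (cong_mod S)"
    unfolding transp_def cong_mod_def by (metis hull_add diff_add_cancel add_diff_eq)
qed

lemma cong_mod_refl [simp]: "cong_mod S x x"
  by (simp add: cong_mod_def hull_zero)

lemma cong_mod_base: "x - y \<in> S \<Longrightarrow> cong_mod S x y"
  by (simp add: cong_mod_def hull_inc)

lemma cong_mod_add: "cong_mod S x y \<Longrightarrow> cong_mod S x' y' \<Longrightarrow> cong_mod S (x + x') (y + y')"
  unfolding cong_mod_def by (metis hull_add add_diff_add)

lemma cong_mod_uminus: "cong_mod S x y \<Longrightarrow> cong_mod S (- x) (- y)"
  unfolding cong_mod_def by (metis hull_uminus minus_diff_minus)

lemma cong_mod_minus: "cong_mod S x y \<Longrightarrow> cong_mod S x' y' \<Longrightarrow> cong_mod S (x - x') (y - y')"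
  using cong_mod_add[OF _ cong_mod_uminus, of S x y x' y'] by simp

lemma cong_mod_mult:
  assumes "cong_mod S x y" "cong_mod S x' y'"
  shows "cong_mod S (x * x') (y * y')"
proof -
  have "x * x' - y * y' = x * (x' - y') + (x - y) * y'"
    by (simp add: algebra_simps)
  then show ?thesis
    using assms by (simp add: cong_mod_def hull_add hull_mult_left hull_mult_right)
qed

lemma (in scalar_embedding) free_eval_cong_mod:
  assumes "cong_mod S p q" and S: "\<And>r. r \<in> S \<Longrightarrow> free_eval \<iota> f r = 0"
  shows "free_eval \<iota> f p = free_eval \<iota> f q"
proof -
  have "two_sided_ideal {r. free_eval \<iota> f r = 0}"
    by (simp add: two_sided_ideal_def free_eval_zero free_eval_add free_eval_mult)
  then have "two_sided_ideal hull S \<subseteq> {r. free_eval \<iota> f r = 0}"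
    using S by (intro hull_minimal) auto
  then show ?thesis
    using assms(1) by (auto simp: cong_mod_def free_eval_minus)
qed


section \<open>The algebra Q\<close>

text \<open>
  The finite type \<open>'n\<close>, which is nonempty, stands for the index set \<open>{1..n}\<close> with \<open>n = CARD('n) \<ge> 1\<close>.
  A generator is a pair \<open>(A, i)\<close> with \<open>i \<notin> A\<close>.
\<close>

typedef 'n gen = "{(A :: 'n set, i :: 'n). i \<notin> A}"
  by auto

definition free_z :: "'n set \<Rightarrow> 'n \<Rightarrow> 'n gen word \<Rightarrow>\<^sub>0 'k::field" where
  "free_z A i = Poly_Mapping.single (Word [Abs_gen (A, i)]) 1"

definition Q_relators :: "('n gen word \<Rightarrow>\<^sub>0 'k::field) set" where
  "Q_relators =
     {(free_z (insert i A) j + free_z A i) - (free_z (insert j A) i + free_z A j)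
        | A i j. i \<notin> A \<and> j \<notin> A \<and> i \<noteq> j} \<union>
     {free_z (insert i A) j * free_z A i - free_z (insert j A) i * free_z A j
        | A i j. i \<notin> A \<and> j \<notin> A \<and> i \<noteq> j}"

quotient_type (overloaded) ('n, 'k) Q = "'n::finite gen word \<Rightarrow>\<^sub>0 'k::field" /
    "cong_mod Q_relators"
  by (rule equivp_cong_mod)

instantiation Q :: (finite, field) ring_1
begin

lift_definition zero_Q :: "('a, 'b) Q" is 0 .

lift_definition one_Q :: "('a, 'b) Q" is 1 .

lift_definition plus_Q :: "('a, 'b) Q \<Rightarrow> ('a, 'b) Q \<Rightarrow> ('a, 'b) Q" is "(+)"
  by (rule cong_mod_add)

lift_definition uminus_Q :: "('a, 'b) Q \<Rightarrow> ('a, 'b) Q" is uminus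
  by (rule cong_mod_uminus)

lift_definition minus_Q :: "('a, 'b) Q \<Rightarrow> ('a, 'b) Q \<Rightarrow> ('a, 'b) Q" is "(-)"
  by (rule cong_mod_minus)

lift_definition times_Q :: "('a, 'b) Q \<Rightarrow> ('a, 'b) Q \<Rightarrow> ('a, 'b) Q" is "(*)"
  by (rule cong_mod_mult)

instance
proof
  show "(0 :: ('a, 'b) Q) \<noteq> 1"
  proof (transfer, rule notI)
    interpret scalar_embedding "id :: 'b \<Rightarrow> 'b"
      by standard simp_all
    assume "cong_mod Q_relators (0 :: 'a gen word \<Rightarrow>\<^sub>0 'b) 1"
    then have "free_eval id (\<lambda>_. 0 :: 'b) (0 :: 'a gen word \<Rightarrow>\<^sub>0 'b) =
        free_eval id (\<lambda>_. 0) (1 :: 'a gen word \<Rightarrow>\<^sub>0 'b)"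
      by (rule free_eval_cong_mod)
        (auto simp: Q_relators_def free_z_def free_eval_minus free_eval_add free_eval_mult
          free_eval_single)
    then show False
      by (simp add: free_eval_zero free_eval_one)
  qed
next
  fix x y t :: "('a, 'b) Q"
  show "x + y + t = x + (y + t)" by transfer (simp add: add.assoc)
  show "x + y = y + x" by transfer (simp add: add.commute)
  show "0 + x = x" by transfer simp
  show "- x + x = 0" by transfer simp
  show "x - y = x + - y" by transfer simp
  show "x * y * t = x * (y * t)" by transfer (simp add: mult.assoc)
  show "1 * x = x" by transfer simp
  show "x * 1 = x" by transfer simp
  show "(x + y) * t = x * t + y * t" by transfer (simp add: distrib_right)
  show "x * (y + t) = x * y + x * t" by transfer (simp add: distrib_left)
qed

end

lift_definition scale_Q :: "'k::field \<Rightarrow> ('n::finite, 'k) Q \<Rightarrow> ('n, 'k) Q" is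
  "\<lambda>c p. Poly_Mapping.single 0 c * p"
  by (rule cong_mod_mult) simp_all

lemma scale_Q_add_right: "scale_Q c (x + y) = scale_Q c x + scale_Q c y"
  by transfer (simp add: distrib_left)

lemma scale_Q_add_left: "scale_Q (c + d) x = scale_Q c x + scale_Q d x"
  by transfer (simp add: distrib_right single_add)

lemma scale_Q_scale: "scale_Q c (scale_Q d x) = scale_Q (c * d) x"
  by transfer (simp add: mult_single flip: mult.assoc)

lemma scale_Q_one: "scale_Q 1 x = x"
  by transfer simp

global_interpretation Q: vector_space "scale_Q :: 'k::field \<Rightarrow> ('n::finite, 'k) Q \<Rightarrow> ('n, 'k) Q"
  by standard (rule scale_Q_add_right scale_Q_add_left scale_Q_scale scale_Q_one)+

text \<open>The value of \<open>zQ A i\<close> for \<open>i \<in> A\<close> is irrelevant; \<open>Abs_gen\<close> is unspecified there.\<close>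

lift_definition zQ :: "'n::finite set \<Rightarrow> 'n \<Rightarrow> ('n, 'k::field) Q" is free_z .

lemma zQ_linear_relation:
  assumes "i \<notin> A" "j \<notin> A" "i \<noteq> j"
  shows "zQ (insert i A) j + zQ A i = zQ (insert j A) i + zQ A j"
  using assms by (transfer, intro cong_mod_base) (unfold Q_relators_def, blast)

lemma zQ_quadratic_relation:
  assumes "i \<notin> A" "j \<notin> A" "i \<noteq> j"
  shows "zQ (insert i A) j * zQ A i = zQ (insert j A) i * zQ A j"
  using assms by (transfer, intro cong_mod_base) (unfold Q_relators_def, blast)

definition T_space :: "('n::finite, 'k::field) Q set" where
  "T_space = Q.span {zQ A i | A i. i \<notin> A}"

definition T_bar :: "('n::finite, 'k::field) Q set" where
  "T_bar = {t + scale_Q c 1 | t c. t \<in> T_space}"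

text \<open>The projection of \<open>T_bar\<close> onto \<open>T_space\<close> along the scalars.\<close>

definition proj_T :: "('n::finite, 'k::field) Q \<Rightarrow> ('n, 'k) Q" where
  "proj_T x = (THE t. t \<in> T_space \<and> (\<exists>c. x = t + scale_Q c 1))"


section \<open>The polynomial ring and the homomorphism \<open>\<psi>\<close>\<close>

text \<open>The monomials in variables indexed by \<open>'n\<close> are the exponent vectors \<open>'n \<Rightarrow>\<^sub>0 nat\<close>.\<close>

type_synonym ('n, 'k) mpoly = "('n \<Rightarrow>\<^sub>0 nat) \<Rightarrow>\<^sub>0 'k"

definition pvar :: "'n \<Rightarrow> ('n, 'k::field) mpoly" where
  "pvar i = Poly_Mapping.single (Poly_Mapping.single i 1) 1"

definition poly_const :: "'k::field \<Rightarrow> ('n, 'k) mpoly" where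
  "poly_const c = Poly_Mapping.single 0 c"

interpretation poly_const: scalar_embedding "poly_const :: 'k::field \<Rightarrow> ('n, 'k) mpoly"
  by standard (simp_all add: poly_const_def single_add mult_single)

lift_definition psi :: "('n::finite, 'k::field) Q \<Rightarrow> ('n, 'k) mpoly" is
  "free_eval poly_const (\<lambda>g. pvar (snd (Rep_gen g)))"
  by (erule poly_const.free_eval_cong_mod)
    (auto simp: Q_relators_def free_z_def poly_const.free_eval_minus poly_const.free_eval_add
      poly_const.free_eval_mult poly_const.free_eval_single poly_const.emb_one Abs_gen_inverse)

lemma psi_one: "psi 1 = 1"
  by transfer (simp add: poly_const.free_eval_one)

lemma psi_add: "psi (x + y) = psi x + psi y"
  by transfer (simp add: poly_const.free_eval_add)

lemma psi_mult: "psi (x * y) = psi x * psi y"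
  by transfer (simp add: poly_const.free_eval_mult)

lemma psi_scale: "psi (scale_Q c x) = poly_const c * psi x"
  by transfer (simp add: poly_const.free_eval_mult poly_const.free_eval_single)

lemma psi_zQ: "i \<notin> A \<Longrightarrow> psi (zQ A i) = pvar i"
  by transfer (simp add: free_z_def poly_const.free_eval_single poly_const.emb_one Abs_gen_inverse)


section \<open>The algebra K and the homomorphism \<open>\<phi>\<close>\<close>

definition K_relators :: "('n, 'k::field) mpoly set" where
  "K_relators = {(pvar i)\<^sup>2 + pvar i | i. True}"

quotient_type (overloaded) ('n, 'k) K = "('n::finite, 'k::field) mpoly" / "cong_mod K_relators"
  by (rule equivp_cong_mod)

lemma lookup_mult_zero:
  fixes p q :: "('n, 'k::field) mpoly"
  shows "Poly_Mapping.lookup (p * q) 0 = Poly_Mapping.lookup p 0 * Poly_Mapping.lookup q 0"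
proof -
  have split: "(0 = a + b) = (a = 0 \<and> b = 0)" for a b :: "'n \<Rightarrow>\<^sub>0 nat"
    by (auto simp: poly_mapping_eq_iff fun_eq_iff lookup_add)
  have "Poly_Mapping.lookup (p * q) 0 =
      (\<Sum>a. Poly_Mapping.lookup p a * (\<Sum>b. Poly_Mapping.lookup q b when a = 0 \<and> b = 0))"
    by (simp add: lookup_mult split)
  also have "\<dots> = (\<Sum>a. Poly_Mapping.lookup p a * (Poly_Mapping.lookup q 0) when a = 0)"
    by (intro arg_cong[where f = Sum_any] ext) (auto simp: when_def)
  finally show ?thesis
    by simp
qed

instantiation K :: (finite, field) comm_ring_1
begin

lift_definition zero_K :: "('a, 'b) K" is 0 .

lift_definition one_K :: "('a, 'b) K" is 1 .

lift_definition plus_K :: "('a, 'b) K \<Rightarrow> ('a, 'b) K \<Rightarrow> ('a, 'b) K" is "(+)"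
  by (rule cong_mod_add)

lift_definition uminus_K :: "('a, 'b) K \<Rightarrow> ('a, 'b) K" is uminus
  by (rule cong_mod_uminus)

lift_definition minus_K :: "('a, 'b) K \<Rightarrow> ('a, 'b) K \<Rightarrow> ('a, 'b) K" is "(-)"
  by (rule cong_mod_minus)

lift_definition times_K :: "('a, 'b) K \<Rightarrow> ('a, 'b) K \<Rightarrow> ('a, 'b) K" is "(*)"
  by (rule cong_mod_mult)

instance
proof
  show "(0 :: ('a, 'b) K) \<noteq> 1"
  proof (transfer, rule notI)
    have "two_sided_ideal {p :: ('a, 'b) mpoly. Poly_Mapping.lookup p 0 = 0}"
      by (simp add: two_sided_ideal_def lookup_add lookup_mult_zero)
    moreover have "Poly_Mapping.lookup (pvar i :: ('a, 'b) mpoly) 0 = 0" for i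
      by (simp add: pvar_def lookup_single when_def poly_mapping_eq_iff fun_eq_iff)
    ultimately have "two_sided_ideal hull K_relators \<subseteq>
        {p :: ('a, 'b) mpoly. Poly_Mapping.lookup p 0 = 0}"
      by (intro hull_minimal)
        (auto simp: K_relators_def lookup_add lookup_mult_zero power2_eq_square)
    moreover assume "cong_mod K_relators (0 :: ('a, 'b) mpoly) 1"
    ultimately show False
      by (auto simp: cong_mod_def)
  qed
next
  fix x y t :: "('a, 'b) K"
  show "x + y + t = x + (y + t)" by transfer (simp add: add.assoc)
  show "x + y = y + x" by transfer (simp add: add.commute)
  show "0 + x = x" by transfer simp
  show "- x + x = 0" by transfer simp
  show "x - y = x + - y" by transfer simp
  show "x * y * t = x * (y * t)" by transfer (simp add: mult.assoc)
  show "x * y = y * x" by transfer (simp add: mult.commute)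
  show "1 * x = x" by transfer simp
  show "(x + y) * t = x * t + y * t" by transfer (simp add: distrib_right)
qed

end

lift_definition K_const :: "'k::field \<Rightarrow> ('n::finite, 'k) K" is poly_const .

lift_definition wK :: "'n::finite \<Rightarrow> ('n, 'k::field) K" is pvar .

lemma w_square: "(wK i)\<^sup>2 + wK i = 0"
  unfolding power2_eq_square
  by (transfer, rule cong_mod_base) (auto simp: K_relators_def power2_eq_square)

interpretation K_const: scalar_embedding "K_const :: 'k::field \<Rightarrow> ('n::finite, 'k) K"
proof
  fix a b :: 'k
  show "K_const 0 = (0 :: ('n, 'k) K)" by transfer (simp add: poly_const.emb_zero)
  show "K_const 1 = (1 :: ('n, 'k) K)" by transfer (simp add: poly_const.emb_one)
  show "K_const (a + b) = (K_const a + K_const b :: ('n, 'k) K)"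
    by transfer (simp add: poly_const.emb_add)
  show "K_const (a * b) = (K_const a * K_const b :: ('n, 'k) K)"
    by transfer (simp add: poly_const.emb_mult)
qed

definition uK :: "'n::finite set \<Rightarrow> 'n set \<Rightarrow> ('n, 'k::field) K" where
  "uK A B = (\<Prod>i\<in>B. wK i) * (\<Prod>j\<in>A. 1 + wK j)"

lemma uK_linear_relation:
  assumes "i \<notin> A" "j \<notin> A" "i \<noteq> j"
  shows "uK (insert i A) {j} + uK A {i} = uK (insert j A) {i} + uK A {j}"
  using assms by (simp add: uK_def algebra_simps)

lemma uK_quadratic_relation:
  assumes "i \<notin> A" "j \<notin> A" "i \<noteq> j"
  shows "uK (insert i A) {j} * uK A {i} =
    (uK (insert j A) {i} * uK A {j} :: ('a::finite, 'b::field) K)"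
proof -
  have *: "wK k * (1 + wK k) = (0 :: ('a, 'b) K)" for k
    using w_square[of k] by (simp add: algebra_simps power2_eq_square)
  let ?P = "\<Prod>k\<in>A. 1 + wK k :: ('a, 'b) K"
  have "uK (insert i A) {j} * uK A {i} = wK j * ?P * ?P * (wK i * (1 + wK i))"
    and "uK (insert j A) {i} * uK A {j} = wK i * ?P * ?P * (wK j * (1 + wK j))"
    using assms by (simp_all add: uK_def ac_simps)
  then show ?thesis
    by (simp only: * mult_zero_right)
qed

lift_definition phi :: "('n::finite, 'k::field) Q \<Rightarrow> ('n, 'k) K" is
  "free_eval K_const (\<lambda>g. case Rep_gen g of (A, i) \<Rightarrow> uK A {i})"
  by (erule K_const.free_eval_cong_mod)
    (auto simp: Q_relators_def free_z_def K_const.free_eval_minus K_const.free_eval_add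
      K_const.free_eval_mult K_const.free_eval_single K_const.emb_one Abs_gen_inverse
      intro: uK_linear_relation uK_quadratic_relation)

lemma phi_one: "phi 1 = 1"
  by transfer (simp add: K_const.free_eval_one)

lemma phi_add: "phi (x + y) = phi x + phi y"
  by transfer (simp add: K_const.free_eval_add)

lemma phi_mult: "phi (x * y) = phi x * phi y"
  by transfer (simp add: K_const.free_eval_mult)

lemma phi_scale: "phi (scale_Q c x) = K_const c * phi x"
  by transfer (simp add: K_const.free_eval_mult K_const.free_eval_single)

lemma phi_zQ: "i \<notin> A \<Longrightarrow> phi (zQ A i) = wK i * (\<Prod>j\<in>A. 1 + wK j)"
  by transfer
    (simp add: free_z_def K_const.free_eval_single K_const.emb_one Abs_gen_inverse uK_def)


section \<open>The elements \<open>z_{A,B}\<close>\<close>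

text \<open>
  \<open>phi\<close> restricts to a bijection from \<open>T_bar\<close> onto the whole algebra and \<open>T_bar\<close> is the direct sum
  of \<open>T_space\<close> and the scalars, so neither \<open>inv_into\<close> nor \<open>THE\<close> makes an arbitrary choice here.
\<close>

definition zAB :: "'n::finite set \<Rightarrow> 'n set \<Rightarrow> ('n, 'k::field) Q" where
  "zAB A B = proj_T (inv_into T_bar phi (uK A B))"

end

theory Submission
  imports Defs
begin

text \<open>
  The relations \<open>w\<^sub>i\<^sup>2 + w\<^sub>i = 0\<close> make \<open>K\<close> the ring of functions on the cube \<open>{0, -1}\<^sup>n\<close>, so a
  subset \<open>S\<close> of the index set, read as the point with coordinate \<open>-1\<close> on \<open>S\<close> and \<open>0\<close> elsewhere,
  gives an evaluation homomorphism \<open>K_eval S\<close> from \<open>K\<close> to the base field.  The difference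
  \<open>f(0) - f(-e\<^sub>i)\<close> of two evaluations is the coefficient of \<open>w\<^sub>i\<close> in the square-free expansion of
  \<open>f\<close>.  Collecting these coefficients gives a linear map \<open>linear_part\<close> from \<open>K\<close> to the
  polynomial ring, \<open>f \<mapsto> \<Sum>\<^sub>i (f(0) - f(-e\<^sub>i)) v\<^sub>i\<close>.

  For \<open>i \<notin> A\<close> this map sends \<open>w\<^sub>i \<Prod>\<^sub>j\<^sub>\<in>\<^sub>A (1 + w\<^sub>j)\<close> to \<open>v\<^sub>i\<close>, because all other terms of the expansion have degree
  at least two.  Hence \<open>psi\<close> agrees on \<open>T_space\<close> with \<open>linear_part \<circ> phi\<close>
  (\<open>psi_eq_linear_part_phi\<close>).  As \<open>linear_part\<close> also kills \<open>1\<close>, the value of \<open>psi\<close> on the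
  \<open>T_space\<close> component of any \<open>x \<in> T_bar\<close> depends only on \<open>phi x\<close>: it is the linear part of
  \<open>phi x\<close> (\<open>psi_proj_T\<close>).  For \<open>z\<^bsub>A,B\<^esub>\<close> this element of \<open>K\<close> is
  \<open>\<Prod>\<^sub>i\<^sub>\<in>\<^sub>B w\<^sub>i \<Prod>\<^sub>j\<^sub>\<in>\<^sub>A (1 + w\<^sub>j)\<close>, which has no linear part when \<open>B\<close> has at least two elements
  (\<open>linear_part_uK\<close>).

  Two facts make the definition of \<open>z\<^bsub>A,B\<^esub>\<close> usable: that product has a preimage in \<open>T_bar\<close>
  (\<open>uK_in_phi_T_space\<close>), and \<open>T_space\<close> meets the scalars only in \<open>0\<close>, so that the projection is
  well defined (\<open>proj_T_eqI\<close>).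
\<close>

section \<open>Monoid algebras and their characters\<close>

definition char_eval :: "('m \<Rightarrow> 'k) \<Rightarrow> ('m \<Rightarrow>\<^sub>0 'k::comm_ring_1) \<Rightarrow> 'k" where
  "char_eval \<chi> p = (\<Sum>m\<in>Poly_Mapping.keys p. Poly_Mapping.lookup p m * \<chi> m)"

lemma char_eval_superset:
  assumes "finite M" "Poly_Mapping.keys p \<subseteq> M"
  shows "char_eval \<chi> p = (\<Sum>m\<in>M. Poly_Mapping.lookup p m * \<chi> m)"
  unfolding char_eval_def using assms
  by (intro sum.mono_neutral_left) (auto simp: in_keys_iff)

lemma char_eval_zero: "char_eval \<chi> 0 = 0"
  by (simp add: char_eval_def)

lemma char_eval_single: "char_eval \<chi> (Poly_Mapping.single m c) = c * \<chi> m"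
  by (simp add: char_eval_def)

lemma char_eval_add: "char_eval \<chi> (p + q) = char_eval \<chi> p + char_eval \<chi> q"
proof -
  have "Poly_Mapping.keys (p + q) \<subseteq> Poly_Mapping.keys p \<union> Poly_Mapping.keys q"
    by (rule Poly_Mapping.keys_add)
  then show ?thesis
    by (simp add: char_eval_superset[of "Poly_Mapping.keys p \<union> Poly_Mapping.keys q"] lookup_add
        distrib_right sum.distrib)
qed

lemma char_eval_sum: "char_eval \<chi> (sum g M) = (\<Sum>x\<in>M. char_eval \<chi> (g x))"
  by (induction M rule: infinite_finite_induct) (simp_all add: char_eval_add char_eval_zero)

lemma char_eval_mult:
  fixes \<chi> :: "'m::monoid_add \<Rightarrow> 'k::comm_ring_1"
  assumes \<chi>: "\<And>m m'. \<chi> (m + m') = \<chi> m * \<chi> m'"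
  shows "char_eval \<chi> (p * q) = char_eval \<chi> p * char_eval \<chi> q"
proof -
  have expand: "r = (\<Sum>m\<in>Poly_Mapping.keys r. Poly_Mapping.single m (Poly_Mapping.lookup r m))"
    for r :: "'m \<Rightarrow>\<^sub>0 'k"
    by (rule poly_mapping_eqI) (simp add: lookup_sum lookup_single when_def in_keys_iff)
  have "p * q = (\<Sum>m\<in>Poly_Mapping.keys p. \<Sum>m'\<in>Poly_Mapping.keys q.
      Poly_Mapping.single (m + m') (Poly_Mapping.lookup p m * Poly_Mapping.lookup q m'))"
    by (subst expand[of p], subst expand[of q]) (simp add: sum_product mult_single)
  then have "char_eval \<chi> (p * q) = (\<Sum>m\<in>Poly_Mapping.keys p. \<Sum>m'\<in>Poly_Mapping.keys q.
      (Poly_Mapping.lookup p m * \<chi> m) * (Poly_Mapping.lookup q m' * \<chi> m'))"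
    by (simp add: char_eval_sum char_eval_single \<chi> ac_simps)
  then show ?thesis
    by (simp add: char_eval_def sum_product)
qed


section \<open>Evaluation at the points of the cube\<close>

definition cube_char :: "'n::finite set \<Rightarrow> ('n \<Rightarrow>\<^sub>0 nat) \<Rightarrow> 'k::field" where
  "cube_char S m = (\<Prod>i\<in>UNIV. (if i \<in> S then -1 else 0) ^ Poly_Mapping.lookup m i)"

lemma cube_char_zero: "cube_char S 0 = 1"
  by (simp add: cube_char_def)

lemma cube_char_add: "cube_char S (m + m') = cube_char S m * cube_char S m'"
  by (simp add: cube_char_def lookup_add power_add prod.distrib)

lemma char_eval_pvar:
  "char_eval (cube_char S) (pvar i :: ('n::finite, 'k::field) mpoly) = (if i \<in> S then -1 else 0)"
proof -
  have "cube_char S (Poly_Mapping.single i 1) =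
      (\<Prod>j\<in>UNIV. if j = i then (if i \<in> S then -1 else 0 :: 'k) else 1)"
    unfolding cube_char_def
    by (intro prod.cong refl) (auto simp: lookup_single when_def)
  then show ?thesis
    by (simp add: pvar_def char_eval_single)
qed

text \<open>
  Both \<open>0\<close> and \<open>-1\<close> are roots of \<open>v\<^sup>2 + v\<close>, so evaluation at a point of the cube kills the ideal
  generated by the relators of \<open>K\<close>.
\<close>

lift_definition K_eval :: "'n::finite set \<Rightarrow> ('n, 'k::field) K \<Rightarrow> 'k" is
  "\<lambda>S. char_eval (cube_char S)"
proof -
  fix S :: "'n set" and p q :: "('n, 'k) mpoly"
  assume "cong_mod K_relators p q"
  moreover have "two_sided_ideal {r :: ('n, 'k) mpoly. char_eval (cube_char S) r = 0}"
    by (simp add: two_sided_ideal_def char_eval_zero char_eval_add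
        char_eval_mult cube_char_add)
  then have "two_sided_ideal hull K_relators \<subseteq>
      {r :: ('n, 'k) mpoly. char_eval (cube_char S) r = 0}"
    by (intro hull_minimal)
      (auto simp: K_relators_def power2_eq_square char_eval_add char_eval_mult
        cube_char_add char_eval_pvar)
  ultimately have "char_eval (cube_char S) (p - q) = 0"
    by (auto simp: cong_mod_def)
  then show "char_eval (cube_char S) p = char_eval (cube_char S) q"
    using char_eval_add[of "cube_char S" "p - q" q] by simp
qed

lemma K_eval_add: "K_eval S (f + g) = K_eval S f + K_eval S g"
  by transfer (rule char_eval_add)

lemma K_eval_mult: "K_eval S (f * g) = K_eval S f * K_eval S g"
  by transfer (rule char_eval_mult, rule cube_char_add)

lemma K_eval_const: "K_eval S (K_const c) = c"
  by transfer (simp add: poly_const_def char_eval_single cube_char_zero)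

lemma K_eval_one: "K_eval S 1 = 1"
  using K_eval_const[of S 1] by (simp add: K_const.emb_one)

lemma K_eval_zero: "K_eval S 0 = 0"
  using K_eval_const[of S 0] by (simp add: K_const.emb_zero)

lemma K_eval_w: "K_eval S (wK i) = (if i \<in> S then -1 else 0)"
  by transfer (rule char_eval_pvar)

lemma K_eval_prod: "K_eval S (prod g I) = (\<Prod>i\<in>I. K_eval S (g i))"
  by (induction I rule: infinite_finite_induct) (simp_all add: K_eval_mult K_eval_one)

lemma K_eval_uK:
  "K_eval S (uK A B :: ('n::finite, 'k::field) K) = (if B \<subseteq> S \<and> A \<inter> S = {} then (-1) ^ card B else 0)"
proof -
  have "(\<Prod>i\<in>B. if i \<in> S then -1 else 0 :: 'k) = (if B \<subseteq> S then (-1) ^ card B else 0)"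
    by (auto simp: subset_iff)
  moreover have "(\<Prod>j\<in>A. 1 + (if j \<in> S then -1 else 0 :: 'k)) = (if A \<inter> S = {} then 1 else 0)"
    by (auto intro!: prod.neutral)
  ultimately show ?thesis
    by (simp add: uK_def K_eval_mult K_eval_prod K_eval_add K_eval_one K_eval_w)
qed


section \<open>The linear part\<close>

definition linear_part :: "('n::finite, 'k::field) K \<Rightarrow> ('n, 'k) mpoly" where
  "linear_part f = (\<Sum>i\<in>UNIV. poly_const (K_eval {} f - K_eval {i} f) * pvar i)"

lemma linear_part_zero: "linear_part 0 = 0"
  by (simp add: linear_part_def K_eval_zero poly_const.emb_zero)

lemma linear_part_add: "linear_part (f + g) = linear_part f + linear_part g"
  by (simp add: linear_part_def K_eval_add add_diff_add poly_const.emb_add distrib_right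
      sum.distrib)

lemma linear_part_scale: "linear_part (K_const c * f) = poly_const c * linear_part f"
  by (simp add: linear_part_def K_eval_mult K_eval_const poly_const.emb_mult mult.assoc
      sum_distrib_left flip: right_diff_distrib)

lemma linear_part_const: "linear_part (K_const c) = 0"
  by (simp add: linear_part_def K_eval_const poly_const.emb_zero)

text \<open>
  Each of the points \<open>0\<close> and \<open>-e\<^sub>i\<close> has a zero coordinate in any \<open>B\<close> with two or more elements, so
  the product of the \<open>w\<^sub>j\<close> over \<open>B\<close> vanishes at all of them.
\<close>

lemma linear_part_uK:
  assumes "2 \<le> card B"
  shows "linear_part (uK A B) = 0"
proof -
  have "\<not> B \<subseteq> {}" "\<And>i. \<not> B \<subseteq> {i}"
    using assms card_mono[of "{_}" B] by (auto dest!: subset_singletonD)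
  then show ?thesis
    by (simp add: linear_part_def K_eval_uK poly_const.emb_zero)
qed

lemma linear_part_uK_singleton:
  assumes "i \<notin> A"
  shows "linear_part (uK A {i}) = pvar i"
proof -
  have "linear_part (uK A {i}) = (\<Sum>j\<in>UNIV. if j = i then pvar i else 0)"
    unfolding linear_part_def
    using assms by (intro sum.cong refl) (auto simp: K_eval_uK poly_const.emb_zero poly_const.emb_one)
  then show ?thesis
    by simp
qed


section \<open>The component in the span of the generators\<close>

lemma phi_zQ_uK: "i \<notin> A \<Longrightarrow> phi (zQ A i) = uK A {i}"
  by (simp add: phi_zQ uK_def)

lemma phi_zero: "phi 0 = 0"
  using phi_add[of 0 0] by simp

lemma phi_scalar: "phi (scale_Q c 1) = K_const c"
  by (simp add: phi_scale phi_one)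

lemma psi_zero: "psi 0 = 0"
  using psi_add[of 0 0] by simp

lemma T_space_induct [consumes 1, case_names zero add]:
  assumes "t \<in> T_space" "P 0"
    and "\<And>c A i t. i \<notin> A \<Longrightarrow> P t \<Longrightarrow> P (scale_Q c (zQ A i) + t)"
  shows "P t"
  using assms(1) unfolding T_space_def
  by (induction rule: Q.span_induct_alt) (use assms(2,3) in auto)

lemma psi_eq_linear_part_phi:
  assumes "t \<in> T_space"
  shows "psi t = linear_part (phi t)"
  using assms
  by (induction rule: T_space_induct)
    (simp_all add: psi_zero phi_zero linear_part_zero psi_add psi_scale psi_zQ phi_add phi_scale
      phi_zQ_uK linear_part_add linear_part_scale linear_part_uK_singleton)

lemma K_eval_origin_phi:
  assumes "t \<in> T_space"
  shows "K_eval {} (phi t) = 0"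
  using assms
  by (induction rule: T_space_induct)
    (simp_all add: phi_zero phi_add phi_scale phi_zQ_uK K_eval_zero K_eval_add K_eval_mult K_eval_uK)

text \<open>
  Evaluating \<open>phi\<close> at the origin kills \<open>T_space\<close> and sends \<open>1\<close> to \<open>1\<close>; it therefore reads off the
  scalar in a decomposition, which makes the decomposition unique.
\<close>

lemma proj_T_eqI:
  assumes "t \<in> T_space"
  shows "proj_T (t + scale_Q c 1) = t"
  unfolding proj_T_def
proof (rule the_equality)
  show "t \<in> T_space \<and> (\<exists>d. t + scale_Q c 1 = t + scale_Q d 1)"
    using assms by blast
next
  fix t' assume "t' \<in> T_space \<and> (\<exists>d. t + scale_Q c 1 = t' + scale_Q d 1)"
  then obtain d where t': "t' \<in> T_space" and eq: "t + scale_Q c 1 = t' + scale_Q d 1"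
    by blast
  have "K_eval {} (phi (t + scale_Q c 1)) = c" "K_eval {} (phi (t' + scale_Q d 1)) = d"
    using assms t' by (simp_all add: phi_add phi_scalar K_eval_add K_eval_const K_eval_origin_phi)
  then have "c = d"
    using eq by simp
  then show "t' = t"
    using eq by simp
qed

lemma psi_proj_T:
  assumes "x \<in> T_bar"
  shows "psi (proj_T x) = linear_part (phi x)"
proof -
  obtain t c where "t \<in> T_space" and "x = t + scale_Q c 1"
    using assms by (auto simp: T_bar_def)
  then show ?thesis
    by (simp add: proj_T_eqI psi_eq_linear_part_phi phi_add phi_scalar linear_part_add
        linear_part_const)
qed

text \<open>
  Writing one factor \<open>w\<^sub>i\<close> with \<open>i \<in> B\<close> as \<open>(1 + w\<^sub>i) - 1\<close> trades it for a difference of two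
  products with the smaller set \<open>B - {i}\<close>.  Repeating this leaves only singletons \<open>B\<close>, and those
  products are images of generators.  The products with \<open>A \<inter> B \<noteq> {}\<close> vanish because
  \<open>w\<^sub>i (1 + w\<^sub>i) = 0\<close>.
\<close>

lemma uK_in_phi_T_space:
  assumes "B \<noteq> {}"
  shows "(uK A B :: ('n::finite, 'k::field) K) \<in> phi ` T_space"
proof -
  have vanish: "(uK A' (insert i B') :: ('n, 'k) K) = 0" if "i \<in> A'" "i \<notin> B'" for i A' B'
  proof -
    have "wK i * (1 + wK i) = (0 :: ('n, 'k) K)"
      using w_square[of i] by (simp add: algebra_simps power2_eq_square)
    moreover have "(uK A' (insert i B') :: ('n, 'k) K) =
        (wK i * (1 + wK i)) * (prod wK B' * (\<Prod>j\<in>A' - {i}. 1 + wK j))"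
      using that by (simp add: uK_def prod.remove[of A' i] ac_simps)
    ultimately show ?thesis
      by simp
  qed
  have zero: "(0 :: ('n, 'k) K) \<in> phi ` T_space"
    by (rule image_eqI[of _ _ 0]) (simp_all add: phi_zero T_space_def Q.span_zero)
  from finite[of B] assms show ?thesis
  proof (induction B arbitrary: A rule: finite_ne_induct)
    case (singleton i)
    show ?case
    proof (cases "i \<in> A")
      case True
      then show ?thesis
        using vanish[of i A "{}"] zero by simp
    next
      case False
      then have "zQ A i \<in> T_space"
        by (auto simp: T_space_def intro: Q.span_base)
      with False show ?thesis
        by (metis phi_zQ_uK image_eqI)
    qed
  next
    case (insert i B')
    show ?case
    proof (cases "i \<in> A")
      case True
      then show ?thesis
        using vanish[of i A B'] insert.hyps zero by simp
    next
      case False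
      obtain s t :: "('n, 'k) Q" where s: "s \<in> T_space" "uK (insert i A) B' = phi s"
        and t: "t \<in> T_space" "uK A B' = phi t"
        using insert.IH[of "insert i A"] insert.IH[of A] by blast
      have "(uK A (insert i B') :: ('n, 'k) K) + uK A B' = uK (insert i A) B'"
        using False insert.hyps by (simp add: uK_def algebra_simps)
      moreover have "phi (s - t) + phi t = phi s"
        by (simp flip: phi_add)
      ultimately have "uK A (insert i B') = phi (s - t)"
        using s(2) t(2) by (metis add_right_cancel)
      moreover have "s - t \<in> T_space"
        using s(1) t(1) by (auto simp: T_space_def intro: Q.span_diff)
      ultimately show ?thesis
        by blast
    qed
  qed
qed

theorem proposition1p2p5:
  fixes A B :: "'n::finite set"
  assumes "2 \<le> card B"
  shows "psi (zAB A B :: ('n, 'k::field) Q) = 0"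
proof -
  let ?u = "uK A B :: ('n, 'k) K"
  let ?x = "inv_into T_bar phi ?u"
  have "B \<noteq> {}"
    using assms by auto
  moreover have "(T_space :: ('n, 'k) Q set) \<subseteq> T_bar"
  proof
    fix t :: "('n, 'k) Q"
    assume "t \<in> T_space"
    moreover have "t = t + scale_Q 0 1"
      by simp
    ultimately show "t \<in> T_bar"
      unfolding T_bar_def by blast
  qed
  ultimately have "?u \<in> phi ` T_bar"
    using uK_in_phi_T_space[of B A] by blast
  then have "?x \<in> T_bar" "phi ?x = ?u"
    by (rule inv_into_into, rule f_inv_into_f)
  then show ?thesis
    using linear_part_uK[OF assms, of A] by (simp add: zAB_def psi_proj_T)
qed

end
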